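(* Let $(X,T)$ be a topological dynamical system. If $(X,T)$ is transitive, then $(X,T)$ is either almost weakly mean equicontinuous or strong mean sensitive.
   Context: A topological dynamical system $(X,T)$ consists of a nonempty compact metric space $X$ with metric $d$ and a continuous map $T:X\to X$. It is transitive if some point $x\in X$ has dense forward orbit $\{x,Tx,T^2x,\dots\}$ (such $x$ is called a transitive point). $S_n$ denotes the group of permutations of $\{1,\dots,n\}$. For $x,y\in X$ put $\overline{F}(x,y)=\limsup_{n\to\infty}\inf_{\sigma\in S_n}\frac1n\sum_{k=1}^n d(T^kx,T^{\sigma(k)}y)$. A point $x\in X$ is weakly mean equicontinuous if for every $\varepsilon>0$ there is $\delta>0$ such that $\overline{F}(x,y)<\varepsilon$ for every $y\in X$ with $d(x,y)<\delta$. $(X,T)$ is almost weakly mean equicontinuous if it is transitive and has at least one weakly mean equicontinuous point. $(X,T)$ is strong mean sensitive if there exists $\delta>0$ such that for every $x\in X$ and every $\varepsilon>0$ there is $y\in X$ with $d(x,y)<\varepsilon$ and $\overline{F}(x,y)>\delta$. *)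

theory Defs
  imports "HOL-Analysis.Analysis" "HOL-Combinatorics.Permutations"
begin

text \<open>
  The space is a nonempty compact subset \<open>X\<close> of a metric space type, with the restricted
  metric \<open>dist\<close>; only the values of \<open>T\<close> on \<open>X\<close> matter.
\<close>

definition topological_dynamical_system :: "'a::metric_space set \<Rightarrow> ('a \<Rightarrow> 'a) \<Rightarrow> bool" where
  "topological_dynamical_system X T \<longleftrightarrow>
     X \<noteq> {} \<and> compact X \<and> continuous_on X T \<and> T ` X \<subseteq> X"

definition transitive_point :: "'a::metric_space set \<Rightarrow> ('a \<Rightarrow> 'a) \<Rightarrow> 'a \<Rightarrow> bool" where
  "transitive_point X T x \<longleftrightarrow> x \<in> X \<and> X \<subseteq> closure (range (\<lambda>n. (T ^^ n) x))"

definition transitive_system :: "'a::metric_space set \<Rightarrow> ('a \<Rightarrow> 'a) \<Rightarrow> bool" where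
  "transitive_system X T \<longleftrightarrow> (\<exists>x. transitive_point X T x)"

text \<open>
  The upper limit is taken in \<open>ereal\<close>. The sequence takes values between 0 and the diameter of
  \<open>X\<close>, so for points of \<open>X\<close> this is the real upper limit. The infimum ranges over a finite
  nonempty set of reals.
\<close>

definition F_upper :: "('a::metric_space \<Rightarrow> 'a) \<Rightarrow> 'a \<Rightarrow> 'a \<Rightarrow> ereal" where
  "F_upper T x y =
     limsup (\<lambda>n. ereal (INF \<sigma>\<in>{\<sigma>. \<sigma> permutes {1..n}}.
       (1 / real n) * (\<Sum>k=1..n. dist ((T ^^ k) x) ((T ^^ (\<sigma> k)) y))))"

definition weakly_mean_equicontinuous_point ::
    "'a::metric_space set \<Rightarrow> ('a \<Rightarrow> 'a) \<Rightarrow> 'a \<Rightarrow> bool" where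
  "weakly_mean_equicontinuous_point X T x \<longleftrightarrow>
     x \<in> X \<and> (\<forall>\<epsilon>::real>0. \<exists>\<delta>::real>0. \<forall>y\<in>X. dist x y < \<delta> \<longrightarrow> F_upper T x y < ereal \<epsilon>)"

definition almost_weakly_mean_equicontinuous ::
    "'a::metric_space set \<Rightarrow> ('a \<Rightarrow> 'a) \<Rightarrow> bool" where
  "almost_weakly_mean_equicontinuous X T \<longleftrightarrow>
     transitive_system X T \<and> (\<exists>x. weakly_mean_equicontinuous_point X T x)"

definition strong_mean_sensitive :: "'a::metric_space set \<Rightarrow> ('a \<Rightarrow> 'a) \<Rightarrow> bool" where
  "strong_mean_sensitive X T \<longleftrightarrow>
     (\<exists>\<delta>::real>0. \<forall>x\<in>X. \<forall>\<epsilon>::real>0. \<exists>y\<in>X. dist x y < \<epsilon> \<and> F_upper T x y > ereal \<delta>)"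

end

theory Submission
  imports Defs
begin

text \<open>
  The two alternatives exclude each other because sensitivity at a weakly mean equicontinuous
  point contradicts equicontinuity there. The substance is that a transitive system which is not
  strong mean sensitive has a weakly mean equicontinuous point, and in fact every transitive point
  \<open>z\<close> is one.

  Failure of sensitivity gives, for each \<open>\<delta> > 0\<close>, a ball around some point \<open>x\<close> on which
  \<open>F_upper T x\<close> is at most \<open>\<delta>\<close>. The orbit of \<open>z\<close> enters that ball, say at time \<open>m\<close>, and by
  continuity so do the orbits at time \<open>m\<close> of all points \<open>y\<close> near \<open>z\<close>. Since \<open>F_upper T\<close> is a
  pseudometric, \<open>T\<^sup>m z\<close> and \<open>T\<^sup>m y\<close> are at most \<open>2\<delta>\<close> apart. Finally, \<open>F_upper\<close> does not
  see the first \<open>m\<close> steps of the orbits: a matching of the shifted orbits extends to one of the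
  original orbits by matching the initial points with each other, at a cost that vanishes after
  averaging. So \<open>z\<close> and \<open>y\<close> are at most \<open>2\<delta>\<close> apart as well.

  For each \<open>n\<close> the pseudometric and shift properties are statements about the cost of an optimal
  matching between the first \<open>n\<close> terms of two arbitrary sequences (\<open>matching_cost_commute\<close>,
  \<open>matching_cost_triangle\<close>, \<open>matching_cost_Suc\<close>); they pass to the upper limit.
\<close>

section \<open>Optimal matchings of finite segments of sequences\<close>

definition matching_cost :: "nat \<Rightarrow> (nat \<Rightarrow> 'a::metric_space) \<Rightarrow> (nat \<Rightarrow> 'a) \<Rightarrow> real" where
  "matching_cost n u v =
     (INF \<sigma>\<in>{\<sigma>. \<sigma> permutes {1..n}}. (1 / real n) * (\<Sum>k=1..n. dist (u k) (v (\<sigma> k))))"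

lemma matching_cost_le:
  assumes "\<sigma> permutes {1..n}"
  shows "matching_cost n u v \<le> (1 / real n) * (\<Sum>k=1..n. dist (u k) (v (\<sigma> k)))"
  unfolding matching_cost_def
  using assms by (intro cInf_lower bdd_below_finite finite_imageI finite_permutations) auto

lemma matching_cost_attained:
  obtains \<sigma> where "\<sigma> permutes {1..n}"
    "matching_cost n u v = (1 / real n) * (\<Sum>k=1..n. dist (u k) (v (\<sigma> k)))"
proof -
  let ?c = "\<lambda>\<sigma>. (1 / real n) * (\<Sum>k=1..n. dist (u k) (v (\<sigma> k)))"
  let ?C = "?c ` {\<sigma>. \<sigma> permutes {1..n}}"
  have fin: "finite ?C"
    by (intro finite_imageI finite_permutations) auto
  have ne: "?C \<noteq> {}"
    using permutes_id by blast
  have "matching_cost n u v = Min ?C"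
    unfolding matching_cost_def using fin ne by (rule cInf_eq_Min)
  also have "\<dots> \<in> ?C"
    using fin ne by (rule Min_in)
  finally show thesis
    using that by blast
qed

lemma matching_cost_commute: "matching_cost n u v = matching_cost n v u"
proof -
  have le: "matching_cost n v u \<le> matching_cost n u v" for u v :: "nat \<Rightarrow> 'a"
  proof -
    obtain \<sigma> where \<sigma>: "\<sigma> permutes {1..n}"
      and opt: "matching_cost n u v = (1 / real n) * (\<Sum>k=1..n. dist (u k) (v (\<sigma> k)))"
      by (rule matching_cost_attained)
    have "(\<Sum>k=1..n. dist (v k) (u (inv \<sigma> k)))
        = (\<Sum>k=1..n. dist (v (\<sigma> k)) (u (inv \<sigma> (\<sigma> k))))"
      using sum.permute[OF \<sigma>, of "\<lambda>k. dist (v k) (u (inv \<sigma> k))"] by (simp add: o_def)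
    also have "\<dots> = (\<Sum>k=1..n. dist (u k) (v (\<sigma> k)))"
      by (simp add: permutes_inverses(2)[OF \<sigma>] dist_commute)
    finally show ?thesis
      using matching_cost_le[OF permutes_inv[OF \<sigma>], of v u] opt by simp
  qed
  show ?thesis
    by (intro antisym le)
qed

text \<open>
  Composing an optimal matching from \<open>u\<close> to \<open>v\<close> with one from \<open>v\<close> to \<open>w\<close> gives a matching from
  \<open>u\<close> to \<open>w\<close>, to which the triangle inequality applies term by term.
\<close>

lemma matching_cost_triangle:
  "matching_cost n u w \<le> matching_cost n u v + matching_cost n v w"
proof -
  obtain \<sigma> where \<sigma>: "\<sigma> permutes {1..n}"
    and opt\<sigma>: "matching_cost n u v = (1 / real n) * (\<Sum>k=1..n. dist (u k) (v (\<sigma> k)))"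
    by (rule matching_cost_attained)
  obtain \<tau> where \<tau>: "\<tau> permutes {1..n}"
    and opt\<tau>: "matching_cost n v w = (1 / real n) * (\<Sum>k=1..n. dist (v k) (w (\<tau> k)))"
    by (rule matching_cost_attained)
  have "(\<Sum>k=1..n. dist (u k) (w ((\<tau> \<circ> \<sigma>) k)))
      \<le> (\<Sum>k=1..n. dist (u k) (v (\<sigma> k)) + dist (v (\<sigma> k)) (w (\<tau> (\<sigma> k))))"
    by (intro sum_mono) (simp add: dist_triangle)
  also have "\<dots> = (\<Sum>k=1..n. dist (u k) (v (\<sigma> k))) + (\<Sum>k=1..n. dist (v k) (w (\<tau> k)))"
    using sum.permute[OF \<sigma>, of "\<lambda>k. dist (v k) (w (\<tau> k))"] by (simp add: sum.distrib o_def)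
  finally have "(1 / real n) * (\<Sum>k=1..n. dist (u k) (w ((\<tau> \<circ> \<sigma>) k)))
      \<le> (1 / real n) * ((\<Sum>k=1..n. dist (u k) (v (\<sigma> k))) + (\<Sum>k=1..n. dist (v k) (w (\<tau> k))))"
    by (intro mult_left_mono) auto
  then show ?thesis
    using matching_cost_le[OF permutes_compose[OF \<sigma> \<tau>], of u w] opt\<sigma> opt\<tau>
    by (simp add: distrib_left)
qed

lemma permutes_shift_Suc:
  assumes "\<sigma> permutes {1..n}"
  shows "case_nat 0 (\<lambda>j. Suc (\<sigma> j)) permutes {1..Suc n}"
proof (rule bij_imp_permutes)
  let ?\<tau> = "case_nat 0 (\<lambda>j. Suc (\<sigma> j))"
  have bij: "bij_betw \<sigma> {0..n} {0..n}"
    using permutes_imp_bij[OF permutes_subset[OF assms, of "{0..n}"]] by auto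
  have Suc_bij: "bij_betw Suc {0..n} {1..Suc n}"
    by (simp add: bij_betw_def image_Suc_atLeastAtMost)
  have "bij_betw (Suc \<circ> \<sigma> \<circ> the_inv_into {0..n} Suc) {1..Suc n} {1..Suc n}"
    by (intro bij_betw_trans[OF bij_betw_the_inv_into[OF Suc_bij]]
        bij_betw_trans[OF bij Suc_bij])
  moreover have "(Suc \<circ> \<sigma> \<circ> the_inv_into {0..n} Suc) k = ?\<tau> k" if k: "k \<in> {1..Suc n}" for k
  proof -
    obtain j where j: "k = Suc j" "j \<in> {0..n}"
      using k by (cases k) auto
    then show ?thesis
      by (simp add: the_inv_into_f_f)
  qed
  ultimately show "bij_betw ?\<tau> {1..Suc n} {1..Suc n}"
    using bij_betw_cong by blast
  show "?\<tau> k = k" if "k \<notin> {1..Suc n}" for k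
    using that assms by (cases k) (auto simp: permutes_not_in)
qed

text \<open>
  Any matching of the shifted sequences extends by matching the two first terms with each other.
  The additional term, divided by the length \<open>n + 1\<close>, tends to 0, so dropping the first terms
  cannot decrease the upper limit of the costs.
\<close>

lemma matching_cost_Suc:
  "matching_cost (Suc n) u v
     \<le> dist (u 1) (v 1) / real (Suc n) + matching_cost n (\<lambda>k. u (Suc k)) (\<lambda>k. v (Suc k))"
proof -
  obtain \<sigma> where \<sigma>: "\<sigma> permutes {1..n}"
    and opt: "matching_cost n (\<lambda>k. u (Suc k)) (\<lambda>k. v (Suc k))
      = (1 / real n) * (\<Sum>k=1..n. dist (u (Suc k)) (v (Suc (\<sigma> k))))"
    by (rule matching_cost_attained)
  define S where "S = (\<Sum>k=1..n. dist (u (Suc k)) (v (Suc (\<sigma> k))))"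
  let ?\<tau> = "case_nat 0 (\<lambda>j. Suc (\<sigma> j))"
  have \<sigma>0: "\<sigma> 0 = 0"
    using \<sigma> by (simp add: permutes_not_in)
  have "(\<Sum>k=1..Suc n. dist (u k) (v (?\<tau> k))) = (\<Sum>k=0..n. dist (u (Suc k)) (v (Suc (\<sigma> k))))"
    using sum.shift_bounds_cl_Suc_ivl[of "\<lambda>k. dist (u k) (v (?\<tau> k))" 0 n] by simp
  also have "\<dots> = dist (u 1) (v 1) + S"
    by (simp add: sum.atLeast_Suc_atMost \<sigma>0 S_def)
  finally have "matching_cost (Suc n) u v \<le> (1 / real (Suc n)) * (dist (u 1) (v 1) + S)"
    using matching_cost_le[OF permutes_shift_Suc[OF \<sigma>], of u v] by simp
  also have "\<dots> = dist (u 1) (v 1) / real (Suc n) + S / real (Suc n)"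
    by (simp add: add_divide_distrib)
  also have "S / real (Suc n) \<le> S / real n"
  proof (cases "n = 0")
    case True
    then show ?thesis by (simp add: S_def)
  next
    case False
    have "0 \<le> S"
      by (simp add: S_def sum_nonneg)
    with False show ?thesis
      by (intro divide_left_mono) auto
  qed
  finally show ?thesis
    using opt by (simp add: S_def)
qed

section \<open>The limiting cost as a shift-invariant pseudometric\<close>

lemma F_upper_eq_limsup_matching_cost:
  "F_upper T x y
     = limsup (\<lambda>n. ereal (matching_cost n (\<lambda>k. (T ^^ k) x) (\<lambda>k. (T ^^ k) y)))"
  by (simp add: F_upper_def matching_cost_def)

lemma F_upper_commute: "F_upper T x y = F_upper T y x"
  unfolding F_upper_eq_limsup_matching_cost by (subst matching_cost_commute) (rule refl)

lemma F_upper_triangle: "F_upper T x z \<le> F_upper T x y + F_upper T y z"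
proof -
  let ?c = "\<lambda>x y n. matching_cost n (\<lambda>k. (T ^^ k) x) (\<lambda>k. (T ^^ k) y)"
  have "limsup (\<lambda>n. ereal (?c x z n)) \<le> limsup (\<lambda>n. ereal (?c x y n) + ereal (?c y z n))"
    by (intro Limsup_mono always_eventually allI) (simp add: matching_cost_triangle)
  also have "\<dots> \<le> limsup (\<lambda>n. ereal (?c x y n)) + limsup (\<lambda>n. ereal (?c y z n))"
    by (rule ereal_limsup_add_mono)
  finally show ?thesis
    by (simp add: F_upper_eq_limsup_matching_cost)
qed

lemma F_upper_le_shift: "F_upper T x y \<le> F_upper T (T x) (T y)"
proof -
  let ?c = "\<lambda>x y n. matching_cost n (\<lambda>k. (T ^^ k) x) (\<lambda>k. (T ^^ k) y)"
  let ?d = "\<lambda>n. dist (T x) (T y) / real (Suc n)"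
  have "(\<lambda>n. ereal (?d n)) \<longlonglongrightarrow> ereal 0"
    by (intro tendsto_ereal LIMSEQ_Suc[OF lim_const_over_n])
  then have lim0: "limsup (\<lambda>n. ereal (?d n)) = 0"
    by (simp add: lim_imp_Limsup zero_ereal_def)
  have "?c x y (Suc n) \<le> ?d n + ?c (T x) (T y) n" for n
    using matching_cost_Suc[of n "\<lambda>k. (T ^^ k) x" "\<lambda>k. (T ^^ k) y"]
    by (simp add: funpow_swap1)
  then have "limsup (\<lambda>n. ereal (?c x y (Suc n)))
      \<le> limsup (\<lambda>n. ereal (?d n) + ereal (?c (T x) (T y) n))"
    by (intro Limsup_mono always_eventually allI) simp
  also have "\<dots> \<le> limsup (\<lambda>n. ereal (?d n)) + limsup (\<lambda>n. ereal (?c (T x) (T y) n))"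
    by (rule ereal_limsup_add_mono)
  finally have "limsup (\<lambda>n. ereal (?c x y n)) \<le> limsup (\<lambda>n. ereal (?c (T x) (T y) n))"
    using limsup_shift[of "\<lambda>n. ereal (?c x y n)"] unfolding lim0 by simp
  then show ?thesis
    by (simp only: F_upper_eq_limsup_matching_cost)
qed

lemma F_upper_le_funpow: "F_upper T x y \<le> F_upper T ((T ^^ m) x) ((T ^^ m) y)"
proof (induction m)
  case (Suc m)
  then show ?case
    using F_upper_le_shift[of T "(T ^^ m) x" "(T ^^ m) y"] by simp
qed simp

section \<open>The dichotomy\<close>

lemma funpow_image_subset:
  assumes "T ` X \<subseteq> X"
  shows "(T ^^ m) ` X \<subseteq> X"
  using assms by (induction m) auto

lemma continuous_on_funpow:
  assumes "continuous_on X T" "T ` X \<subseteq> X"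
  shows "continuous_on X (T ^^ m)"
proof (induction m)
  case 0
  then show ?case by (simp add: id_def)
next
  case (Suc m)
  have "continuous_on X (T \<circ> (T ^^ m))"
    using Suc continuous_on_subset[OF assms(1) funpow_image_subset[OF assms(2)]]
    by (rule continuous_on_compose)
  then show ?case by simp
qed

lemma transitive_point_weakly_mean_equicontinuous:
  assumes cont: "continuous_on X T" and inv: "T ` X \<subseteq> X"
    and z: "transitive_point X T z" and not_sens: "\<not> strong_mean_sensitive X T"
  shows "weakly_mean_equicontinuous_point X T z"
  unfolding weakly_mean_equicontinuous_point_def
proof (intro conjI allI impI)
  show zX: "z \<in> X"
    using z by (simp add: transitive_point_def)
  fix \<epsilon> :: real
  assume "\<epsilon> > 0"
  \<comment> \<open>The bound is used twice in the triangle inequality through \<open>x\<close>; with \<open>\<epsilon> / 3\<close> the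
    resulting inequality is strict.\<close>
  then have "\<epsilon> / 3 > 0" by simp
  then obtain x r where x: "x \<in> X" and r: "r > 0"
    and small: "\<And>y. y \<in> X \<Longrightarrow> dist x y < r \<Longrightarrow> F_upper T x y \<le> ereal (\<epsilon> / 3)"
    using not_sens unfolding strong_mean_sensitive_def by (meson not_le)
  have "x \<in> closure (range (\<lambda>n. (T ^^ n) z))"
    using x z by (auto simp: transitive_point_def)
  then obtain m where m: "dist ((T ^^ m) z) x < r"
    using r by (auto simp: closure_approachable)
  have mapsX: "(T ^^ m) y \<in> X" if "y \<in> X" for y
    using funpow_image_subset[OF inv, of m] that by blast
  have "r - dist ((T ^^ m) z) x > 0"
    using m by simp
  then obtain \<eta> where \<eta>: "\<eta> > 0"
    and near: "\<And>y. y \<in> X \<Longrightarrow> dist y z < \<eta> \<Longrightarrow>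
      dist ((T ^^ m) y) ((T ^^ m) z) < r - dist ((T ^^ m) z) x"
    using continuous_on_funpow[OF cont inv, of m] zX unfolding continuous_on_iff by blast
  have "F_upper T z y < ereal \<epsilon>" if y: "y \<in> X" "dist z y < \<eta>" for y
  proof -
    have "dist x ((T ^^ m) y) < r"
      using near[of y] y dist_triangle[of "(T ^^ m) y" x "(T ^^ m) z"]
      by (simp add: dist_commute)
    then have Fy: "F_upper T x ((T ^^ m) y) \<le> ereal (\<epsilon> / 3)"
      using small mapsX y by blast
    have Fz: "F_upper T ((T ^^ m) z) x \<le> ereal (\<epsilon> / 3)"
      using small[of "(T ^^ m) z"] mapsX zX m
      by (simp add: dist_commute F_upper_commute[of T _ x])
    have "F_upper T z y \<le> F_upper T ((T ^^ m) z) ((T ^^ m) y)"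
      by (rule F_upper_le_funpow)
    also have "\<dots> \<le> F_upper T ((T ^^ m) z) x + F_upper T x ((T ^^ m) y)"
      by (rule F_upper_triangle)
    also have "\<dots> \<le> ereal (\<epsilon> / 3) + ereal (\<epsilon> / 3)"
      using Fz Fy by (rule add_mono)
    also have "\<dots> < ereal \<epsilon>"
      using \<open>\<epsilon> > 0\<close> by simp
    finally show ?thesis .
  qed
  then show "\<exists>\<eta>>0. \<forall>y\<in>X. dist z y < \<eta> \<longrightarrow> F_upper T z y < ereal \<epsilon>"
    using \<eta> by blast
qed

lemma weakly_mean_equicontinuous_point_not_sensitive:
  assumes "weakly_mean_equicontinuous_point X T x"
  shows "\<not> strong_mean_sensitive X T"
  using assms unfolding weakly_mean_equicontinuous_point_def strong_mean_sensitive_def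
  by (meson not_less_iff_gr_or_eq)

theorem theorem5p5:
  fixes X :: "'a::metric_space set" and T :: "'a \<Rightarrow> 'a"
  assumes "topological_dynamical_system X T"
    and "transitive_system X T"
  shows "(almost_weakly_mean_equicontinuous X T \<or> strong_mean_sensitive X T)
       \<and> \<not> (almost_weakly_mean_equicontinuous X T \<and> strong_mean_sensitive X T)"
proof
  obtain z where "transitive_point X T z"
    using assms(2) by (auto simp: transitive_system_def)
  then show "almost_weakly_mean_equicontinuous X T \<or> strong_mean_sensitive X T"
    using assms transitive_point_weakly_mean_equicontinuous[of X T z]
    by (auto simp: almost_weakly_mean_equicontinuous_def topological_dynamical_system_def)
  show "\<not> (almost_weakly_mean_equicontinuous X T \<and> strong_mean_sensitive X T)"
    using weakly_mean_equicontinuous_point_not_sensitive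
    by (auto simp: almost_weakly_mean_equicontinuous_def)
qed

end
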